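(* Let $p$ be a prime, let $r,n\ge 1$ be integers, and let $M$ be a submodule of the $\mathbb{Z}_{p^r}$-module $\mathbb{Z}_{p^r}^n$. Let $M^\perp=\{v\in\mathbb{Z}_{p^r}^n : \langle u,v\rangle=0 \text{ for all } u\in M\}$, where $\langle u,v\rangle=\sum_{i=1}^n x_iy_i$ for $u=(x_1,\dots,x_n)$ and $v=(y_1,\dots,y_n)$. Then $$p\text{-}\dim(M)+p\text{-}\dim(M^\perp)=p\text{-}\dim(\mathbb{Z}_{p^r}^n).$$
   Context: $\mathbb{Z}_{p^r}$ denotes the ring of integers modulo $p^r$, and $\mathcal{A}_p=\{0,1,\dots,p-1\}\subset\mathbb{Z}_{p^r}$. A $p$-linear combination of vectors $v_1,\dots,v_k\in\mathbb{Z}_{p^r}^n$ is a vector $\sum_{j=1}^k a_jv_j$ with all $a_j\in\mathcal{A}_p$; the set of all of these is $p\text{-span}(v_1,\dots,v_k)$. An ordered sequence $(v_1,\dots,v_k)$ in $\mathbb{Z}_{p^r}^n$ is a $p$-generator sequence if $pv_k=0$ and, for each $1\le i\le k-1$, the vector $pv_i$ is a $p$-linear combination of $v_{i+1},\dots,v_k$. Vectors $v_1,\dots,v_k$ are $p$-linearly independent if, for $a_1,\dots,a_k\in\mathcal{A}_p$, $\sum_{j=1}^k a_jv_j=0$ holds only when all $a_j=0$. A $p$-basis is a $p$-linearly independent $p$-generator sequence; it is a $p$-basis of the submodule $M$ if moreover $M=p\text{-span}(v_1,\dots,v_k)$. (The $p$-span of a $p$-generator sequence is always a submodule, equal to the usual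 $\mathbb{Z}_{p^r}$-span.) Every submodule of $\mathbb{Z}_{p^r}^n$ has a $p$-basis. If $M$ has a $p$-basis of length $k$, then $|M|=p^k$, so $k$ depends only on $M$; it is called the $p$-dimension of $M$ and denoted $p\text{-}\dim(M)$. Convention: the empty sequence is a $p$-basis of the zero submodule, which has $p$-dimension $0$. *)

theory Defs
  imports
    "HOL-Analysis.Finite_Cartesian_Product"
    "Berlekamp_Zassenhaus.Finite_Field"
begin

text \<open>
  The ring of integers modulo \<open>q\<close> is \<open>'a mod_ring\<close> with \<open>CARD('a) = q\<close>; the class \<open>nontriv\<close>
  (\<open>CARD('a) > 1\<close>) makes it a commutative ring with one. Its free module of rank
  \<open>n = CARD('n)\<close> is \<open>'a mod_ring ^ 'n\<close>. Below, \<open>p\<close> is an explicit parameter, meant to be the prime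
  with \<open>CARD('a) = p ^ r\<close>. Submodules are the library's \<open>module.subspace\<close>.
\<close>

interpretation mod_vec: Modules.module "(*s) :: 'a::nontriv mod_ring \<Rightarrow> 'a mod_ring ^ 'n \<Rightarrow> 'a mod_ring ^ 'n"
  by unfold_locales (simp_all add: vec_eq_iff algebra_simps)

definition digits :: "nat \<Rightarrow> 'a::nontriv mod_ring set" where
  "digits p = of_nat ` {..<p}"

definition p_span :: "nat \<Rightarrow> ('a::nontriv mod_ring ^ 'n) list \<Rightarrow> ('a mod_ring ^ 'n) set" where
  "p_span p vs =
     {\<Sum>j<length vs. a j *s vs ! j | a :: nat \<Rightarrow> 'a mod_ring. \<forall>j<length vs. a j \<in> digits p}"

text \<open>
  For the last vector the list \<open>drop (Suc i) vs\<close> is empty and \<open>p_span p [] = {0}\<close>, so the condition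
  reads \<open>p v = 0\<close> there.
\<close>

definition p_generator_sequence :: "nat \<Rightarrow> ('a::nontriv mod_ring ^ 'n) list \<Rightarrow> bool" where
  "p_generator_sequence p vs \<longleftrightarrow>
     (\<forall>i<length vs. of_nat p *s vs ! i \<in> p_span p (drop (Suc i) vs))"

definition p_lin_independent :: "nat \<Rightarrow> ('a::nontriv mod_ring ^ 'n) list \<Rightarrow> bool" where
  "p_lin_independent p vs \<longleftrightarrow>
     (\<forall>a :: nat \<Rightarrow> 'a mod_ring.
        (\<forall>j<length vs. a j \<in> digits p) \<longrightarrow> (\<Sum>j<length vs. a j *s vs ! j) = 0 \<longrightarrow>
        (\<forall>j<length vs. a j = 0))"

definition p_basis :: "nat \<Rightarrow> ('a::nontriv mod_ring ^ 'n) list \<Rightarrow> bool" where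
  "p_basis p vs \<longleftrightarrow> p_lin_independent p vs \<and> p_generator_sequence p vs"

definition p_basis_of :: "nat \<Rightarrow> ('a::nontriv mod_ring ^ 'n) list \<Rightarrow> ('a mod_ring ^ 'n) set \<Rightarrow> bool" where
  "p_basis_of p vs M \<longleftrightarrow> p_basis p vs \<and> M = p_span p vs"

definition p_dim :: "nat \<Rightarrow> ('a::nontriv mod_ring ^ 'n) set \<Rightarrow> nat" where
  "p_dim p M = (THE k. \<exists>vs. p_basis_of p vs M \<and> length vs = k)"

definition vec_dot :: "'a::nontriv mod_ring ^ 'n \<Rightarrow> 'a mod_ring ^ 'n \<Rightarrow> 'a mod_ring" where
  "vec_dot u v = (\<Sum>i\<in>UNIV. u $ i * v $ i)"

definition orth_submodule :: "('a::nontriv mod_ring ^ 'n) set \<Rightarrow> ('a mod_ring ^ 'n) set" where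
  "orth_submodule M = {v. \<forall>u\<in>M. vec_dot u v = 0}"

lemma p_span_Nil: "p_span p [] = {0}"
  by (simp add: p_span_def)

lemma p_basis_of_Nil: "p_basis_of p [] {0}"
  by (simp add: p_basis_of_def p_basis_def p_lin_independent_def p_generator_sequence_def p_span_Nil)

end

theory Submission
  imports Defs
begin

text \<open>
  Both sides are compared through cardinalities. Prepending to a p-basis of \<open>N\<close> a vector
  \<open>w \<notin> N\<close> with \<open>p w \<in> N\<close> gives a p-basis of a submodule with \<open>p |N|\<close> elements, because
  a nonzero digit is a unit; such a \<open>w\<close> exists in every larger submodule, as some power of \<open>p\<close>
  kills everything. Hence every submodule \<open>M\<close> has a p-basis, and \<open>|M|\<close> is \<open>p\<close> to its
  p-dimension. The identity \<open>|M| |M\<^sup>\<bottom>|\<close> = number of all vectors follows by evaluating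
  the sum of \<open>\<chi>(\<langle>u, v\<rangle>)\<close> over \<open>u \<in> M\<close> and all \<open>v\<close> in both orders, where \<open>\<chi>\<close> is a
  faithful additive character: the inner sums vanish unless \<open>v \<in> M\<^sup>\<bottom>\<close>, respectively
  \<open>u = 0\<close>.
\<close>

section \<open>Digit multiples modulo a prime power\<close>

lemma of_nat_mod_ring_cong:
  assumes "[k = l] (mod CARD('a::nontriv))"
  shows "(of_nat k :: 'a mod_ring) = of_nat l"
proof -
  have "int k mod int CARD('a) = int l mod int CARD('a)"
    using assms by (metis cong_def of_nat_mod)
  then show ?thesis by transfer
qed

lemma of_nat_mod_ring_surj: "\<exists>k. (c :: 'a::nontriv mod_ring) = of_nat k"
proof -
  have "to_int_mod_ring c \<ge> 0"
    using range_to_int_mod_ring[where 'a='a] by (metis atLeastLessThan_iff rangeI)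
  then have "c = of_nat (nat (to_int_mod_ring c))"
    by (simp add: of_nat_of_int_mod_ring)
  then show ?thesis ..
qed

text \<open>A positive \<open>m\<close> below the prime \<open>p\<close> is coprime to
  \<open>p ^ r\<close>, hence a unit of the ring, and scaling by its inverse stays in
  \<open>N\<close>.\<close>

lemma mem_subspace_if_digit_multiple:
  fixes w :: "'a::nontriv mod_ring ^ 'n"
  assumes "prime p" and card: "CARD('a) = p ^ r" and N: "mod_vec.subspace N"
    and m: "0 < m" "m < p" and mem: "of_nat m *s w \<in> N"
  shows "w \<in> N"
proof -
  have "coprime m (p ^ r)"
    using assms(1) m by (metis coprime_commute coprime_power_right_iff nat_dvd_not_less prime_imp_coprime)
  then obtain s where "[m * s = Suc 0] (mod p ^ r)"
    using cong_solve_coprime_nat by blast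
  then have "(of_nat (m * s) :: 'a mod_ring) = of_nat (Suc 0)"
    using card by (intro of_nat_mod_ring_cong) simp
  then have "of_nat s * of_nat m = (1 :: 'a mod_ring)"
    by (simp add: mult.commute)
  then have "of_nat s *s (of_nat m *s w) = w"
    by (simp add: vector_smult_assoc)
  then show ?thesis
    using mod_vec.subspace_scale[OF N mem, of "of_nat s"] by simp
qed

text \<open>Subtracting the smaller multiple puts a positive digit multiple of \<open>w\<close> into
  \<open>N\<close>, and then \<open>w\<close> itself. This yields both the count of
  \<open>p_extend\<close> and the step for independence.\<close>

lemma digit_multiples_cosets_disjoint:
  fixes w :: "'a::nontriv mod_ring ^ 'n"
  assumes "prime p" "CARD('a) = p ^ r" and N: "mod_vec.subspace N" and w: "w \<notin> N"
    and "m < p" "m' < p" and x: "x \<in> N" "x' \<in> N"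
    and eq: "of_nat m *s w + x = of_nat m' *s w + x'"
  shows "m = m'"
proof -
  have False if lt: "k' < k" and k: "k < p" and y: "y \<in> N" "y' \<in> N"
    and eq: "of_nat k *s w + y = of_nat k' *s w + y'" for k k' y y'
  proof -
    have "of_nat (k - k') *s w = y' - y"
      using lt eq by (simp add: of_nat_diff vector_sub_rdistrib algebra_simps)
    then have "of_nat (k - k') *s w \<in> N"
      using mod_vec.subspace_diff[OF N] y by simp
    then show False
      using mem_subspace_if_digit_multiple[OF assms(1,2) N, of "k - k'" w] lt k w by linarith
  qed
  from this[of m' m x x'] this[of m m' x' x] show ?thesis
    using assms by (cases m m' rule: linorder_cases) auto
qed

section \<open>Extending a submodule by one vector\<close>

text \<open>The union of the cosets m w + N for m < p. Once p w lies in the submodule N, it is the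
  submodule generated by \<open>w\<close> and \<open>N\<close>.\<close>

definition p_extend ::
  "nat \<Rightarrow> 'a::nontriv mod_ring ^ 'n \<Rightarrow> ('a mod_ring ^ 'n) set \<Rightarrow> ('a mod_ring ^ 'n) set" where
  "p_extend p w N = (\<lambda>(m, x). of_nat m *s w + x) ` ({..<p} \<times> N)"

text \<open>Division of the coefficient by \<open>p\<close> leaves a digit as remainder, and the
  quotient part is a multiple of p w, absorbed by \<open>N\<close>. Admitting every \<open>c\<close>
  makes the closure properties of \<open>p_extend\<close> immediate.\<close>

lemma scale_add_in_p_extend:
  fixes w :: "'a::nontriv mod_ring ^ 'n"
  assumes "p > 0" and N: "mod_vec.subspace N" and pw: "of_nat p *s w \<in> N" and x: "x \<in> N"
  shows "c *s w + x \<in> p_extend p w N"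
proof -
  obtain k where k: "c = of_nat k" using of_nat_mod_ring_surj by blast
  have "(of_nat k :: 'a mod_ring) = of_nat (k mod p) + of_nat (k div p) * of_nat p"
    by (metis mod_div_mult_eq of_nat_add of_nat_mult)
  then have "c *s w + x = of_nat (k mod p) *s w + (of_nat (k div p) *s (of_nat p *s w) + x)"
    by (simp add: k vector_sadd_rdistrib vector_smult_assoc add.assoc)
  moreover have "of_nat (k div p) *s (of_nat p *s w) + x \<in> N"
    using mod_vec.subspace_add[OF N] mod_vec.subspace_scale[OF N pw] x by blast
  ultimately show ?thesis
    using \<open>p > 0\<close> unfolding p_extend_def
    by (intro image_eqI[where x="(k mod p, of_nat (k div p) *s (of_nat p *s w) + x)"]) auto
qed

lemma subspace_p_extend:
  fixes w :: "'a::nontriv mod_ring ^ 'n"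
  assumes "p > 0" and N: "mod_vec.subspace N" and pw: "of_nat p *s w \<in> N"
  shows "mod_vec.subspace (p_extend p w N)"
proof (rule mod_vec.subspaceI)
  note mem = scale_add_in_p_extend[OF assms]
  show "0 \<in> p_extend p w N"
    using mem[of 0 0] mod_vec.subspace_0[OF N] by simp
next
  note mem = scale_add_in_p_extend[OF assms]
  fix y z assume "y \<in> p_extend p w N" "z \<in> p_extend p w N"
  then obtain k l x x' where "y = of_nat k *s w + x" "z = of_nat l *s w + x'" "x \<in> N" "x' \<in> N"
    by (auto simp: p_extend_def)
  then show "y + z \<in> p_extend p w N"
    using mem[of "x + x'" "of_nat k + of_nat l"] mod_vec.subspace_add[OF N]
    by (simp add: vector_sadd_rdistrib algebra_simps)
next
  note mem = scale_add_in_p_extend[OF assms]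
  fix c y assume "y \<in> p_extend p w N"
  then obtain k x where "y = of_nat k *s w + x" "x \<in> N"
    by (auto simp: p_extend_def)
  then show "c *s y \<in> p_extend p w N"
    using mem[of "c *s x" "c * of_nat k"] mod_vec.subspace_scale[OF N]
    by (simp add: vector_add_ldistrib vector_smult_assoc)
qed

lemma card_p_extend:
  fixes w :: "'a::nontriv mod_ring ^ 'n"
  assumes "prime p" "CARD('a) = p ^ r" "mod_vec.subspace N" "w \<notin> N"
  shows "card (p_extend p w N) = p * card N"
proof -
  have "inj_on (\<lambda>(m, x). of_nat m *s w + x) ({..<p} \<times> N)"
  proof (rule inj_onI, clarify)
    fix m x m' x'
    assume *: "m < p" "m' < p" "x \<in> N" "x' \<in> N" "of_nat m *s w + x = of_nat m' *s w + x'"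
    then have "m = m'" using digit_multiples_cosets_disjoint[OF assms] by blast
    then show "m = m' \<and> x = x'" using * by simp
  qed
  then show ?thesis
    by (simp add: p_extend_def card_image card_cartesian_product)
qed

section \<open>Existence and length of p-bases\<close>

text \<open>Reduces statements about lists to the one-vector extension, so that all facts on p-spans
  follow by induction on the list.\<close>

lemma p_span_Cons: "p_span p (w # vs) = p_extend p w (p_span p vs)"
proof (intro equalityI subsetI)
  fix y assume "y \<in> p_span p (w # vs)"
  then obtain a where a: "\<forall>j<Suc (length vs). a j \<in> digits p"
    and y: "y = a 0 *s w + (\<Sum>j<length vs. a (Suc j) *s vs ! j)"
    by (auto simp: p_span_def sum.lessThan_Suc_shift simp del: sum.lessThan_Suc)
  obtain m where "m < p" "a 0 = of_nat m" using a by (auto simp: digits_def)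
  moreover have "(\<Sum>j<length vs. a (Suc j) *s vs ! j) \<in> p_span p vs"
    unfolding p_span_def using a by auto
  ultimately show "y \<in> p_extend p w (p_span p vs)"
    unfolding p_extend_def y by force
next
  fix y assume "y \<in> p_extend p w (p_span p vs)"
  then obtain m a where "m < p" and a: "\<forall>j<length vs. a j \<in> digits p"
    and y: "y = of_nat m *s w + (\<Sum>j<length vs. a j *s vs ! j)"
    by (auto simp: p_extend_def p_span_def)
  \<comment> \<open>\<open>case_nat\<close> prepends the digit of \<open>w\<close> to the
    coefficients of the tail.\<close>
  then have "\<forall>j<Suc (length vs). case_nat (of_nat m) a j \<in> digits p"
    by (auto simp: digits_def split: nat.split)
  moreover have "y = (\<Sum>j<Suc (length vs). case_nat (of_nat m) a j *s (w # vs) ! j)"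
    unfolding y by (simp add: sum.lessThan_Suc_shift del: sum.lessThan_Suc)
  ultimately show "y \<in> p_span p (w # vs)"
    unfolding p_span_def by auto
qed

lemma p_generator_sequence_Cons:
  "p_generator_sequence p (w # vs) \<longleftrightarrow>
     of_nat p *s w \<in> p_span p vs \<and> p_generator_sequence p vs"
  by (simp add: p_generator_sequence_def All_less_Suc2)

lemma p_lin_independent_Cons:
  fixes w :: "'a::nontriv mod_ring ^ 'n"
  assumes "prime p" "CARD('a) = p ^ r" and sub: "mod_vec.subspace (p_span p vs)"
  shows "p_lin_independent p (w # vs) \<longleftrightarrow> p_lin_independent p vs \<and> w \<notin> p_span p vs"
proof (intro iffI conjI)
  assume ind: "p_lin_independent p (w # vs)"
  have *: "b = 0 \<and> (\<forall>j<length vs. a j = 0)"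
    if "b \<in> digits p" "\<forall>j<length vs. a j \<in> digits p" "b *s w + (\<Sum>j<length vs. a j *s vs ! j) = 0"
    for a :: "nat \<Rightarrow> 'a mod_ring" and b
    using ind[unfolded p_lin_independent_def, THEN spec, of "case_nat b a"] that
    by (simp add: sum.lessThan_Suc_shift All_less_Suc2 del: sum.lessThan_Suc)
  have "0 \<in> digits p" "1 \<in> digits p"
    unfolding digits_def using prime_gt_1_nat[OF assms(1)]
    by (auto intro: image_eqI[of _ _ 0] image_eqI[of _ _ 1])
  show "p_lin_independent p vs"
    unfolding p_lin_independent_def using *[of 0] \<open>0 \<in> digits p\<close> by auto
  show "w \<notin> p_span p vs"
  proof
    assume "w \<in> p_span p vs"
    \<comment> \<open>Negated digits need not be digits, so \<open>- w\<close> gets its own digit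
      expansion from closure under negation; with coefficient 1 at \<open>w\<close> it forms a
      forbidden relation.\<close>
    then have "- w \<in> p_span p vs" by (rule mod_vec.subspace_neg[OF sub])
    then obtain a where "\<forall>j<length vs. a j \<in> digits p" "- w = (\<Sum>j<length vs. a j *s vs ! j)"
      by (auto simp: p_span_def)
    then have "(1::'a mod_ring) = 0"
      using *[of 1 a] \<open>1 \<in> digits p\<close> by (metis add.right_inverse vector_smult_lid)
    then show False by simp
  qed
next
  assume "p_lin_independent p vs \<and> w \<notin> p_span p vs"
  then have ind: "p_lin_independent p vs" and w: "w \<notin> p_span p vs" by auto
  show "p_lin_independent p (w # vs)"
    unfolding p_lin_independent_def
  proof (rule allI, intro impI)
    fix a :: "nat \<Rightarrow> 'a mod_ring"
    let ?y = "\<Sum>j<length vs. a (Suc j) *s vs ! j"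
    assume dig: "\<forall>j<length (w # vs). a j \<in> digits p"
      and "(\<Sum>j<length (w # vs). a j *s (w # vs) ! j) = 0"
    then have eq: "a 0 *s w + ?y = 0"
      by (simp add: sum.lessThan_Suc_shift del: sum.lessThan_Suc)
    obtain m where m: "m < p" "a 0 = of_nat m" using dig by (auto simp: digits_def)
    have y: "?y \<in> p_span p vs" using dig by (auto simp: p_span_def)
    \<comment> \<open>The zero vector is also 0 w + 0, so disjointness of cosets compares
      \<open>m\<close> with 0.\<close>
    have "m = 0"
      using digit_multiples_cosets_disjoint[OF assms(1,2) sub w m(1) _ y, of 0 0]
        mod_vec.subspace_0[OF sub] prime_gt_0_nat[OF assms(1)] eq m(2) by simp
    then have a0: "a 0 = 0" using m by simp
    then have "\<forall>j<length vs. a (Suc j) = 0"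
      using ind[unfolded p_lin_independent_def, rule_format, of "\<lambda>j. a (Suc j)"] dig eq by simp
    with a0 show "\<forall>j<length (w # vs). a j = 0"
      by (simp add: All_less_Suc2)
  qed
qed

lemma p_generator_sequence_subspace:
  assumes "p > 0" "p_generator_sequence p vs"
  shows "mod_vec.subspace (p_span p vs)"
  using assms(2)
proof (induction vs)
  case Nil
  then show ?case by (simp add: p_span_Nil)
next
  case (Cons w vs)
  then show ?case
    using assms(1) by (simp add: p_generator_sequence_Cons p_span_Cons subspace_p_extend)
qed

lemma p_basis_Cons:
  fixes w :: "'a::nontriv mod_ring ^ 'n"
  assumes "prime p" "CARD('a) = p ^ r"
  shows "p_basis p (w # vs) \<longleftrightarrow>
     p_basis p vs \<and> w \<notin> p_span p vs \<and> of_nat p *s w \<in> p_span p vs"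
  using p_lin_independent_Cons[OF assms, of vs w] p_generator_sequence_subspace[of p vs]
    prime_gt_0_nat[OF assms(1)]
  by (auto simp: p_basis_def p_generator_sequence_Cons)

lemma card_p_span_p_basis:
  fixes vs :: "('a::nontriv mod_ring ^ 'n) list"
  assumes "prime p" "CARD('a) = p ^ r" "p_basis p vs"
  shows "card (p_span p vs) = p ^ length vs"
  using assms(3)
proof (induction vs)
  case Nil
  then show ?case by (simp add: p_span_Nil)
next
  case (Cons w vs)
  then have vs: "p_basis p vs" "w \<notin> p_span p vs"
    by (simp_all add: p_basis_Cons[OF assms(1,2)])
  then have "mod_vec.subspace (p_span p vs)"
    using p_generator_sequence_subspace prime_gt_0_nat[OF assms(1)] by (auto simp: p_basis_def)
  then show ?case
    using vs Cons.IH by (simp add: p_span_Cons card_p_extend[OF assms(1,2)])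
qed

text \<open>Repeated multiplication by \<open>p\<close> brings any \<open>v\<close> in
  \<open>M\<close> outside the span into it, because \<open>p ^ r\<close> vanishes in the ring; the
  last multiple still outside can be prepended.\<close>

lemma p_basis_extend:
  fixes vs :: "('a::nontriv mod_ring ^ 'n) list"
  assumes "prime p" and card: "CARD('a) = p ^ r" and M: "mod_vec.subspace M"
    and vs: "p_basis p vs" and sub: "p_span p vs \<subset> M"
  obtains w where "p_basis p (w # vs)" "p_span p (w # vs) \<subseteq> M"
proof -
  let ?N = "p_span p vs"
  have N: "mod_vec.subspace ?N"
    using p_generator_sequence_subspace prime_gt_0_nat[OF assms(1)] vs by (auto simp: p_basis_def)
  obtain v where v: "v \<in> M" "v \<notin> ?N" using sub by blast
  have "(of_nat (p ^ r) :: 'a mod_ring) = 0"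
    using of_nat_card_eq_0[where 'a='a] card by simp
  then have top: "of_nat (p ^ r) *s v \<in> ?N"
    using mod_vec.subspace_0[OF N] by simp
  define k where "k = (LEAST k. of_nat (p ^ k) *s v \<in> ?N)"
  have k: "of_nat (p ^ k) *s v \<in> ?N"
    unfolding k_def by (rule LeastI[where P="\<lambda>k. of_nat (p ^ k) *s v \<in> ?N", OF top])
  \<comment> \<open>The exponent 0 is excluded because \<open>v\<close> itself lies outside the
    span.\<close>
  then obtain l where l: "k = Suc l"
    using v by (cases k) auto
  define w where "w = of_nat (p ^ l) *s v"
  have "w \<notin> ?N"
    using not_less_Least[of l "\<lambda>k. of_nat (p ^ k) *s v \<in> ?N"] l unfolding w_def k_def by simp
  moreover have "of_nat p *s w \<in> ?N"
    using k unfolding w_def l by (simp add: vector_smult_assoc)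
  moreover have "p_span p (w # vs) \<subseteq> M"
    using sub v mod_vec.subspace_add[OF M] mod_vec.subspace_scale[OF M]
    unfolding p_span_Cons p_extend_def w_def by fastforce
  ultimately show ?thesis
    using that vs by (simp add: p_basis_Cons[OF assms(1,2)])
qed

lemma ex_p_basis_of:
  fixes M :: "('a::nontriv mod_ring ^ 'n) set"
  assumes "prime p" "CARD('a) = p ^ r" and M: "mod_vec.subspace M"
  obtains vs where "p_basis_of p vs M"
proof -
  have "\<exists>us. p_basis_of p us M" if "p_basis p vs" "p_span p vs \<subseteq> M"
    for vs :: "('a mod_ring ^ 'n) list"
    using that
  \<comment> \<open>The measure counts the elements of \<open>M\<close> not yet reached; each
    prepended vector multiplies the size of the span by \<open>p\<close>.\<close>
  proof (induction "card (M - p_span p vs)" arbitrary: vs rule: less_induct)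
    case less
    show ?case
    proof (cases "p_span p vs = M")
      case True
      then show ?thesis using less.prems by (auto simp: p_basis_of_def)
    next
      case False
      then have "p_span p vs \<subset> M" using less.prems by blast
      from p_basis_extend[OF assms less.prems(1) this] obtain w
        where w: "p_basis p (w # vs)" "p_span p (w # vs) \<subseteq> M" .
      have "p_span p vs \<noteq> {}"
        by (metis mod_vec.subspace_0 empty_iff p_generator_sequence_subspace p_basis_def
            prime_gt_0_nat less.prems(1) assms(1))
      have "card (p_span p (w # vs)) = p * card (p_span p vs)"
        using w(1) less.prems(1) by (simp add: card_p_span_p_basis[OF assms(1,2)])
      moreover have "card (p_span p vs) > 0"
        using \<open>p_span p vs \<noteq> {}\<close> by (simp add: card_gt_0_iff)
      ultimately have "card (p_span p vs) < card (p_span p (w # vs))"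
        using prime_gt_1_nat[OF assms(1)] by simp
      moreover have "card (p_span p (w # vs)) \<le> card M"
        using w(2) by (simp add: card_mono)
      ultimately have "card (M - p_span p (w # vs)) < card (M - p_span p vs)"
        using w(2) less.prems(2) by (simp add: card_Diff_subset)
      then show ?thesis using less.hyps w by blast
    qed
  qed
  from this[of "[]"] show thesis
    using that p_basis_of_Nil mod_vec.subspace_0[OF M] by (auto simp: p_basis_of_def p_span_Nil)
qed

text \<open>All p-bases of \<open>M\<close> have the same length, since \<open>p\<close> to that
  length is the size of \<open>M\<close>; so the description in \<open>p_dim\<close>
  denotes.\<close>

lemma card_eq_p_power_p_dim:
  fixes M :: "('a::nontriv mod_ring ^ 'n) set"
  assumes "prime p" "CARD('a) = p ^ r" "mod_vec.subspace M"
  shows "card M = p ^ p_dim p M"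
proof -
  obtain vs where vs: "p_basis_of p vs M" using ex_p_basis_of[OF assms] .
  have card: "card M = p ^ length us" if "p_basis_of p us M" for us
    using that by (auto simp: p_basis_of_def card_p_span_p_basis[OF assms(1,2)])
  have "p_dim p M = length vs"
    unfolding p_dim_def
  proof (rule the_equality)
    show "k = length vs" if "\<exists>us. p_basis_of p us M \<and> length us = k" for k
      using that card vs prime_gt_1_nat[OF assms(1)] by (metis power_inject_exp)
  qed (use vs in blast)
  then show ?thesis using card[OF vs] by simp
qed

section \<open>Orthogonality of additive characters\<close>

text \<open>The character exp(2 pi i x / q) for q = \<open>CARD('a)\<close>, evaluated at the
  representative of \<open>x\<close> in [0, q).\<close>

definition additive_char :: "'a::nontriv mod_ring \<Rightarrow> complex" where
  "additive_char x = cis (2 * pi * (real_of_int (to_int_mod_ring x) / real CARD('a)))"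

lemma additive_char_0 [simp]: "additive_char 0 = 1"
  by (simp add: additive_char_def)

text \<open>Reducing the sum of the representatives modulo q changes the angle by an integer
  multiple of 2 pi.\<close>

lemma additive_char_add:
  "additive_char (x + y) = additive_char x * additive_char (y :: 'a::nontriv mod_ring)"
proof -
  let ?q = "int CARD('a)" and ?s = "to_int_mod_ring x + to_int_mod_ring y"
  have "to_int_mod_ring (x + y) = ?s mod ?q"
    by transfer simp
  then have "?s = to_int_mod_ring (x + y) + (?s div ?q) * ?q"
    by simp
  then have "real_of_int ?s = real_of_int (to_int_mod_ring (x + y)) + real_of_int (?s div ?q) * real CARD('a)"
    by (metis of_int_add of_int_mult of_int_of_nat_eq)
  then have "real_of_int ?s / real CARD('a) =
      real_of_int (to_int_mod_ring (x + y)) / real CARD('a) + real_of_int (?s div ?q)"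
    by (simp add: field_simps)
  then have "cis (2 * pi * (real_of_int ?s / real CARD('a))) =
      additive_char (x + y) * cis (2 * pi * real_of_int (?s div ?q))"
    unfolding additive_char_def cis_mult by (simp only: distrib_left)
  then have "additive_char (x + y) = cis (2 * pi * (real_of_int ?s / real CARD('a)))"
    by simp
  also have "\<dots> = additive_char x * additive_char y"
    unfolding additive_char_def cis_mult by (simp add: add_divide_distrib distrib_left)
  finally show ?thesis .
qed

text \<open>An angle in 2 pi Z makes the representative a multiple of q, and the only one in [0, q)
  is 0.\<close>

lemma additive_char_eq_1_iff: "additive_char x = 1 \<longleftrightarrow> x = (0 :: 'a::nontriv mod_ring)"
proof
  assume "additive_char x = 1"
  then have "cos (2 * pi * (real_of_int (to_int_mod_ring x) / real CARD('a))) = 1"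
    by (simp add: additive_char_def complex_eq_iff)
  then obtain n :: int where
    "2 * pi * (real_of_int (to_int_mod_ring x) / real CARD('a)) = real_of_int n * 2 * pi"
    by (auto simp: cos_one_2pi_int)
  then have "real_of_int (to_int_mod_ring x) = real_of_int (n * int CARD('a))"
    by (simp add: field_simps)
  then have eq: "to_int_mod_ring x = n * int CARD('a)"
    by linarith
  have "to_int_mod_ring x \<in> {0..<int CARD('a)}"
    using range_to_int_mod_ring[where 'a='a] by blast
  then have "to_int_mod_ring x = to_int_mod_ring x mod int CARD('a)"
    by simp
  also have "\<dots> = 0" unfolding eq by simp
  finally show "x = 0" by simp
qed simp

lemma vec_dot_add_left: "vec_dot (u + u') v = vec_dot u v + vec_dot u' v"
  by (simp add: vec_dot_def distrib_right sum.distrib)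

lemma vec_dot_commute: "vec_dot u v = vec_dot v u"
  by (simp add: vec_dot_def mult.commute)

lemma vec_dot_scale_left: "vec_dot (c *s u) v = c * vec_dot u v"
  by (simp add: vec_dot_def sum_distrib_left mult.assoc)

lemma subspace_orth_submodule: "mod_vec.subspace (orth_submodule M)"
proof -
  have "orth_submodule M = {v. \<forall>u\<in>M. vec_dot v u = 0}"
    by (simp add: orth_submodule_def vec_dot_commute)
  moreover have "vec_dot 0 u = 0" for u :: "'a mod_ring ^ 'b"
    by (simp add: vec_dot_def)
  ultimately show ?thesis
    by (auto intro!: mod_vec.subspaceI simp: vec_dot_add_left vec_dot_scale_left)
qed

text \<open>For \<open>v\<close> not orthogonal to \<open>M\<close>, translating the summation by
  some \<open>w\<close> in \<open>M\<close> with nonzero product multiplies the sum by a factor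
  other than 1, so it vanishes.\<close>

lemma sum_additive_char_vec_dot:
  fixes M :: "('a::nontriv mod_ring ^ 'n) set"
  assumes M: "mod_vec.subspace M"
  shows "(\<Sum>u\<in>M. additive_char (vec_dot u v)) = (if v \<in> orth_submodule M then of_nat (card M) else 0)"
proof (cases "v \<in> orth_submodule M")
  case True
  then show ?thesis by (simp add: orth_submodule_def)
next
  case False
  let ?S = "\<Sum>u\<in>M. additive_char (vec_dot u v)"
  obtain w where w: "w \<in> M" "vec_dot w v \<noteq> 0"
    using False by (auto simp: orth_submodule_def)
  have "?S = (\<Sum>u\<in>M. additive_char (vec_dot (w + u) v))"
    by (rule sum.reindex_bij_witness[where i="\<lambda>u. w + u" and j="\<lambda>u. u - w"])
       (use w mod_vec.subspace_add[OF M] mod_vec.subspace_diff[OF M] in auto)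
  also have "\<dots> = additive_char (vec_dot w v) * ?S"
    by (simp add: vec_dot_add_left additive_char_add sum_distrib_left)
  finally have "?S = 0"
    using w additive_char_eq_1_iff by (metis mult_cancel_right1)
  then show ?thesis using False by simp
qed

lemma orth_submodule_UNIV: "orth_submodule UNIV = {0 :: 'a::nontriv mod_ring ^ 'n}"
proof -
  have "v = 0" if "\<forall>u. vec_dot u v = 0" for v :: "'a mod_ring ^ 'n"
  proof -
    \<comment> \<open>Products with the unit vectors read off the coordinates.\<close>
    have "v $ i = vec_dot (axis i 1) v" for i
      by (simp add: vec_dot_def axis_def if_distrib[where f="\<lambda>x. x * _"] cong: if_cong)
    then show ?thesis using that by (simp add: vec_eq_iff)
  qed
  then show ?thesis by (auto simp: orth_submodule_def vec_dot_def)
qed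

lemma card_mult_card_orth_submodule:
  fixes M :: "('a::nontriv mod_ring ^ 'n) set"
  assumes M: "mod_vec.subspace M"
  shows "card M * card (orth_submodule M) = CARD('a mod_ring ^ 'n)"
proof -
  let ?\<chi> = "\<lambda>u v :: 'a mod_ring ^ 'n. additive_char (vec_dot u v)"
  have "(of_nat (card M * card (orth_submodule M)) :: complex) = (\<Sum>v\<in>UNIV. \<Sum>u\<in>M. ?\<chi> u v)"
    by (simp add: sum_additive_char_vec_dot[OF M] sum.If_cases)
  \<comment> \<open>The arguments are also exchanged, by symmetry of the product, so that the same
    lemma applies with \<open>UNIV\<close> as the submodule.\<close>
  also have "\<dots> = (\<Sum>u\<in>M. \<Sum>v\<in>UNIV. ?\<chi> v u)"
    by (subst sum.swap) (simp add: vec_dot_commute)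
  also have "\<dots> = (\<Sum>u\<in>M. if u = 0 then of_nat CARD('a mod_ring ^ 'n) else 0)"
    by (simp add: sum_additive_char_vec_dot[OF mod_vec.subspace_UNIV] orth_submodule_UNIV)
  also have "\<dots> = of_nat CARD('a mod_ring ^ 'n)"
    using mod_vec.subspace_0[OF M] by simp
  finally show ?thesis
    by (simp only: of_nat_eq_iff)
qed

theorem theorem4:
  fixes p r :: nat
    and M :: "('a::nontriv mod_ring ^ 'n) set"
  assumes "prime p" and "r \<ge> 1"
    and "CARD('a) = p ^ r"
    and "mod_vec.subspace M"
  shows "p_dim p M + p_dim p (orth_submodule M) = p_dim p (UNIV :: ('a mod_ring ^ 'n) set)"
proof -
  note card = card_eq_p_power_p_dim[OF assms(1,3)]
  have "p ^ (p_dim p M + p_dim p (orth_submodule M)) = p ^ p_dim p (UNIV :: ('a mod_ring ^ 'n) set)"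
    using card_mult_card_orth_submodule[OF assms(4)]
    by (simp only: power_add card[OF assms(4)] card[OF subspace_orth_submodule]
        card[OF mod_vec.subspace_UNIV])
  then show ?thesis
    using prime_gt_1_nat[OF assms(1)] by (simp add: power_inject_exp)
qed

end
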